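(* Let $k\ge2$ be an integer, let $g_0$ be a $k$-monotone density on $(0,\infty)$, let $X_1,X_2,\dots$ be i.i.d. with density $g_0$, and let $\hat g_n$ be the maximum likelihood estimator of $g_0$ over the class of $k$-monotone densities based on $X_1,\dots,X_n$. Fix $c>0$. Then $$\sup_{x\ge c}|\hat g_n(x)-g_0(x)|\to0\quad\text{almost surely as }n\to\infty.$$
   Context: For $k\ge2$, a function $g$ on $(0,\infty)$ is $k$-monotone if $(-1)^l g^{(l)}$ is nonnegative, nonincreasing and convex for $l=0,\dots,k-2$; $\mathcal D_k$ is the class of $k$-monotone probability densities on $(0,\infty)$. The MLE $\hat g_n$ maximizes $n^{-1}\sum_{i=1}^n\log g(X_i)$ over $g\in\mathcal D_k$. *)

theory Defs
  imports "HOL-Probability.Probability"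
begin

(* A function on the open half-line is represented by a total real function whose
   values on the nonpositive reals are irrelevant: every condition below only
   concerns its values on {0<..}. *)

(* The indices l = 0,...,k-2 are written as l + 2 \<le> k.  The derivatives up to order
   k-2 are required to exist, since deriv is total; for k = 2 this condition is empty.
   The definition is meant for k \<ge> 2. *)
definition k_monotone :: "nat \<Rightarrow> (real \<Rightarrow> real) \<Rightarrow> bool" where
  "k_monotone k g \<longleftrightarrow>
     (\<forall>l. l + 2 < k \<longrightarrow> (deriv ^^ l) g differentiable_on {0<..}) \<and>
     (\<forall>l. l + 2 \<le> k \<longrightarrow>
        (\<forall>x>0. 0 \<le> (-1) ^ l * (deriv ^^ l) g x) \<and>
        antimono_on {0<..} (\<lambda>x. (-1) ^ l * (deriv ^^ l) g x) \<and>
        convex_on {0<..} (\<lambda>x. (-1) ^ l * (deriv ^^ l) g x))"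

definition k_monotone_densities :: "nat \<Rightarrow> (real \<Rightarrow> real) set" where
  "k_monotone_densities k =
     {g. k_monotone k g \<and> (\<integral>\<^sup>+x\<in>{0<..}. ennreal (g x) \<partial>lborel) = 1}"

(* The library has ln 0 = 0; a likelihood needs log 0 = -\<infinity>. *)
definition log_ext :: "real \<Rightarrow> ereal" where
  "log_ext y = (if 0 < y then ereal (ln y) else -\<infinity>)"

(* The sample is x 0, ..., x (n - 1). *)
definition log_likelihood :: "nat \<Rightarrow> (nat \<Rightarrow> real) \<Rightarrow> (real \<Rightarrow> real) \<Rightarrow> ereal" where
  "log_likelihood n x g = (\<Sum>i<n. log_ext (g (x i))) / ereal (real n)"

definition is_k_monotone_mle ::
    "nat \<Rightarrow> nat \<Rightarrow> (nat \<Rightarrow> real) \<Rightarrow> (real \<Rightarrow> real) \<Rightarrow> bool" where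
  "is_k_monotone_mle k n x g \<longleftrightarrow>
     g \<in> k_monotone_densities k \<and>
     (\<forall>h \<in> k_monotone_densities k. log_likelihood n x h \<le> log_likelihood n x g)"

end

theory Submission
  imports Defs
begin

text \<open>
  Write \<open>u\<close> for the true density, \<open>v\<close> for the maximum likelihood estimate, and
  \<open>x\<^sub>0, \<dots>, x\<^sub>n\<^sub>-\<^sub>1\<close> for the sample. The class of \<open>k\<close>-monotone densities is convex, so the
  likelihood cannot increase when \<open>v\<close> is moved towards \<open>u\<close>; the directional derivative of the
  log-likelihood gives the score inequality \<open>(1/n) * (\<Sum>i<n. u(x\<^sub>i) / v(x\<^sub>i)) \<le> 1\<close>
  (\<open>mle_score_inequality\<close>). If the empirical measure could be replaced by the true one, this would
  read \<open>\<integral> u\<^sup>2 / v \<le> 1\<close>, and then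
  \<open>\<integral> (u - v)\<^sup>2 / v = \<integral> u\<^sup>2 / v - 2 * \<integral> u + \<integral> v \<le> 0\<close> would force \<open>v = u\<close>.

  Since \<open>v\<close> depends on the sample, the replacement is done on a finite grid of mesh \<open>h\<close>, where only
  finitely many empirical frequencies are involved. On the cell from \<open>h*j\<close> to \<open>h*(j+1)\<close>, monotonicity
  gives \<open>u \<ge> w\<^sub>j\<close> with \<open>w\<^sub>j = u(h*(j+1))\<close> and \<open>v \<le> s\<^sub>j\<close> with \<open>s\<^sub>j = v(h*j)\<close>, and the cell has
  probability at least \<open>h * w\<^sub>j\<close>. The score inequality thus bounds \<open>\<Sum>j. h * w\<^sub>j\<^sup>2 / s\<^sub>j\<close> by nearly 1.
  The lower Riemann sum of \<open>v\<close> is at most 1, and that of \<open>u\<close> is nearly 1 for a fine and long grid, so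
  the discrete chi-square distance \<open>\<Sum>j. h * (w\<^sub>j - s\<^sub>j)\<^sup>2 / s\<^sub>j\<close> is small, uniformly in \<open>v\<close>
  (\<open>score_chi_square_bound\<close>).

  If \<open>v\<close> were far from \<open>u\<close> at a point \<open>y\<close>, then by monotonicity of \<open>v\<close> and continuity of \<open>u\<close> it
  would be far from \<open>u\<close> on a whole interval to the left or to the right of \<open>y\<close>, with a fixed
  contribution to this distance (\<open>score_close_at_point\<close>). Hence \<open>v(y)\<close> converges to \<open>u(y)\<close>. For
  rational \<open>y\<close> the grid points are rational, so the law of large numbers is needed for countably many
  intervals only; for these bounded variables it follows from Hoeffding's inequality and the
  Borel-Cantelli lemma (\<open>empirical_frequency_tendsto\<close>). Finally, convergence of decreasing densities
  at rational points to a continuous limit is uniform away from 0: monotonicity fills the gaps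
  between finitely many rational points, and the tails are controlled by \<open>v(x) \<le> 1/x\<close> (\<open>decreasing_densities_uniform_limit\<close>).
\<close>

section \<open>Decreasing densities and the class of k-monotone densities\<close>

definition decreasing_density :: "(real \<Rightarrow> real) \<Rightarrow> bool" where
  "decreasing_density v \<longleftrightarrow> antimono_on {0<..} v \<and> (\<forall>x>0. 0 \<le> v x) \<and>
     (\<integral>\<^sup>+x\<in>{0<..}. ennreal (v x) \<partial>lborel) = 1"

lemma decreasing_density_antimono:
  "decreasing_density v \<Longrightarrow> 0 < x \<Longrightarrow> x \<le> y \<Longrightarrow> v y \<le> v x"
  unfolding decreasing_density_def monotone_on_def by auto

lemma decreasing_density_nonneg: "decreasing_density v \<Longrightarrow> 0 < x \<Longrightarrow> 0 \<le> v x"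
  unfolding decreasing_density_def by auto

lemma k_monotone_density_imp_decreasing_density:
  assumes "2 \<le> k" "g \<in> k_monotone_densities k"
  shows "decreasing_density g"
proof -
  have "k_monotone k g" using assms by (auto simp: k_monotone_densities_def)
  then have "\<forall>l. l + 2 \<le> k \<longrightarrow>
        (\<forall>x>0. 0 \<le> (-1) ^ l * (deriv ^^ l) g x) \<and>
        antimono_on {0<..} (\<lambda>x. (-1) ^ l * (deriv ^^ l) g x)"
    unfolding k_monotone_def by blast
  from this[rule_format, of 0] assms show ?thesis
    by (auto simp: decreasing_density_def k_monotone_densities_def)
qed

lemma k_monotone_density_continuous_on:
  assumes "2 \<le> k" "g \<in> k_monotone_densities k"
  shows "continuous_on {0<..} g"
proof -
  have "k_monotone k g" using assms by (auto simp: k_monotone_densities_def)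
  then have "\<forall>l. l + 2 \<le> k \<longrightarrow> convex_on {0<..} (\<lambda>x. (-1) ^ l * (deriv ^^ l) g x)"
    unfolding k_monotone_def by blast
  from this[rule_format, of 0] assms have "convex_on {0<..} g" by simp
  then show ?thesis by (intro convex_on_continuous) auto
qed

text \<open>
  Iterated derivatives are linear only where the lower ones are differentiable. This is where the
  differentiability requirement in the definition of \<open>k\<close>-monotonicity enters.
\<close>

lemma k_monotone_convex_combination:
  assumes f: "k_monotone k f" and g: "k_monotone k g" and e: "0 \<le> e" "e \<le> 1"
  shows "k_monotone k (\<lambda>x. (1 - e) * f x + e * g x)"
proof -
  let ?h = "\<lambda>x. (1 - e) * f x + e * g x"
  have diff: "(deriv ^^ l) q field_differentiable at x"
    if "k_monotone k q" "l + 2 < k" "0 < x" for q l and x :: real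
  proof -
    have "(deriv ^^ l) q differentiable_on {0<..}" using that by (auto simp: k_monotone_def)
    then have "(deriv ^^ l) q differentiable at x"
      using that by (auto simp: differentiable_on_eq_differentiable_at)
    then show ?thesis
      by (simp add: field_differentiable_def real_differentiable_def)
  qed
  have lin: "l + 2 \<le> k \<longrightarrow> (\<forall>x>0. (deriv ^^ l) ?h x = (1 - e) * (deriv ^^ l) f x + e * (deriv ^^ l) g x)" for l
  proof (induction l)
    case 0
    show ?case by simp
  next
    case (Suc l)
    show ?case
    proof (intro impI allI)
      fix x :: real assume l: "Suc l + 2 \<le> k" and x: "0 < x"
      have ev: "eventually (\<lambda>y. y > 0) (nhds x)"
        using x eventually_nhds_in_open[of "{0<..}" x] by simp
      have "deriv ((deriv ^^ l) ?h) x = deriv (\<lambda>y. (1 - e) * (deriv ^^ l) f y + e * (deriv ^^ l) g y) x"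
        using Suc l by (intro deriv_cong_ev eventually_mono[OF ev]) auto
      also have "\<dots> = (1 - e) * deriv ((deriv ^^ l) f) x + e * deriv ((deriv ^^ l) g) x"
      proof -
        have "(deriv ^^ l) f field_differentiable at x" "(deriv ^^ l) g field_differentiable at x"
          using diff[OF f _ x] diff[OF g _ x] l by auto
        then have "((deriv ^^ l) f has_field_derivative deriv ((deriv ^^ l) f) x) (at x)"
           "((deriv ^^ l) g has_field_derivative deriv ((deriv ^^ l) g) x) (at x)"
          by (auto simp: DERIV_deriv_iff_field_differentiable)
        then show ?thesis
          by (intro DERIV_imp_deriv) (auto intro!: derivative_eq_intros)
      qed
      finally show "(deriv ^^ Suc l) ?h x = (1 - e) * (deriv ^^ Suc l) f x + e * (deriv ^^ Suc l) g x"
        by simp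
    qed
  qed
  have lin': "(-1) ^ l * (deriv ^^ l) ?h x
        = (1 - e) * ((-1) ^ l * (deriv ^^ l) f x) + e * ((-1) ^ l * (deriv ^^ l) g x)"
    if "l + 2 \<le> k" "0 < x" for l x
    by (subst lin[rule_format, OF that]) (simp add: algebra_simps)
  show ?thesis
    unfolding k_monotone_def
  proof (intro conjI allI impI)
    fix l assume l: "l + 2 < k"
    have "(\<lambda>x. (1 - e) * (deriv ^^ l) f x + e * (deriv ^^ l) g x) differentiable_on {0<..}"
      using f g l unfolding k_monotone_def
      by (intro derivative_intros) auto
    then show "(deriv ^^ l) ?h differentiable_on {0<..}"
      using lin[of l] l
      by (auto simp: differentiable_on_def intro: differentiable_transform_within[where d=1])
  next
    fix l and x :: real assume l: "l + 2 \<le> k" and x: "0 < x"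
    show "0 \<le> (-1) ^ l * (deriv ^^ l) ?h x"
      unfolding lin'[OF l x] using f g l x e unfolding k_monotone_def
      by (intro add_nonneg_nonneg mult_nonneg_nonneg[of "1 - e"] mult_nonneg_nonneg[of e]) auto
  next
    fix l assume l: "l + 2 \<le> k"
    have *: "antimono_on {0<..} (\<lambda>x. (-1) ^ l * (deriv ^^ l) f x)"
         "antimono_on {0<..} (\<lambda>x. (-1) ^ l * (deriv ^^ l) g x)"
      using f g l unfolding k_monotone_def by blast+
    show "antimono_on {0<..} (\<lambda>x. (-1) ^ l * (deriv ^^ l) ?h x)"
    proof (rule monotone_onI)
      fix x y :: real assume xy: "x \<in> {0<..}" "y \<in> {0<..}" "x \<le> y"
      then have pos: "0 < x" "0 < y" by auto
      show "(-1) ^ l * (deriv ^^ l) ?h y \<le> (-1) ^ l * (deriv ^^ l) ?h x"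
        unfolding lin'[OF l pos(1)] lin'[OF l pos(2)]
        using *[THEN monotone_onD, OF xy] e
        by (intro add_mono mult_left_mono[where c=e] mult_left_mono[where c="1 - e"]) auto
    qed
  next
    fix l assume l: "l + 2 \<le> k"
    have *: "convex_on {0<..} (\<lambda>x. (-1) ^ l * (deriv ^^ l) f x)"
         "convex_on {0<..} (\<lambda>x. (-1) ^ l * (deriv ^^ l) g x)"
      using f g l unfolding k_monotone_def by blast+
    have "convex_on {0<..} (\<lambda>x. (1 - e) * ((-1) ^ l * (deriv ^^ l) f x) + e * ((-1) ^ l * (deriv ^^ l) g x))"
      using * e by (intro convex_on_add convex_on_cmul[where c=e] convex_on_cmul[where c="1 - e"]) auto
    then show "convex_on {0<..} (\<lambda>x. (-1) ^ l * (deriv ^^ l) ?h x)"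
      unfolding convex_on_def
    proof (elim conjE, intro conjI ballI allI impI)
      fix x y a b :: real
      assume conv: "\<forall>x\<in>{0<..}. \<forall>y\<in>{0<..}. \<forall>a\<ge>0. \<forall>b\<ge>0. a + b = 1 \<longrightarrow>
          (1 - e) * ((-1) ^ l * (deriv ^^ l) f (a *\<^sub>R x + b *\<^sub>R y))
            + e * ((-1) ^ l * (deriv ^^ l) g (a *\<^sub>R x + b *\<^sub>R y))
          \<le> a * ((1 - e) * ((-1) ^ l * (deriv ^^ l) f x) + e * ((-1) ^ l * (deriv ^^ l) g x))
            + b * ((1 - e) * ((-1) ^ l * (deriv ^^ l) f y) + e * ((-1) ^ l * (deriv ^^ l) g y))"
        and xy: "x \<in> {0<..}" "y \<in> {0<..}" and ab: "0 \<le> a" "0 \<le> b" "a + b = 1"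
      have "convex {0::real<..}" by simp
      then have "a *\<^sub>R x + b *\<^sub>R y \<in> {0<..}" using xy ab unfolding convex_def by blast
      then have pos: "0 < a *\<^sub>R x + b *\<^sub>R y" "0 < x" "0 < y" using xy by auto
      show "(-1) ^ l * (deriv ^^ l) ?h (a *\<^sub>R x + b *\<^sub>R y)
          \<le> a * ((-1) ^ l * (deriv ^^ l) ?h x) + b * ((-1) ^ l * (deriv ^^ l) ?h y)"
        unfolding lin'[OF l pos(1)] lin'[OF l pos(2)] lin'[OF l pos(3)]
        using conv xy ab by blast
    qed auto
  qed
qed

lemma k_monotone_densities_convex_combination:
  assumes k: "2 \<le> k" and f: "f \<in> k_monotone_densities k" and g: "g \<in> k_monotone_densities k"
    and e: "0 \<le> e" "e \<le> 1"
  shows "(\<lambda>x. (1 - e) * f x + e * g x) \<in> k_monotone_densities k"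
proof -
  have meas: "(\<lambda>x. ennreal (q x) * indicator {0<..} x) \<in> borel_measurable lborel"
    if "q \<in> k_monotone_densities k" for q
  proof -
    have "(\<lambda>x. indicator {0<..} x *\<^sub>R q x) \<in> borel_measurable borel"
      using k_monotone_density_continuous_on[OF k that]
      by (intro borel_measurable_continuous_on_indicator) auto
    then have "(\<lambda>x. ennreal (indicator {0<..} x *\<^sub>R q x)) \<in> borel_measurable borel"
      by measurable
    also have "(\<lambda>x. ennreal (indicator {0<..} x *\<^sub>R q x)) = (\<lambda>x. ennreal (q x) * indicator {0<..} x)"
      by (auto simp: indicator_def fun_eq_iff)
    finally show ?thesis by simp
  qed
  have nn: "0 < x \<Longrightarrow> 0 \<le> f x \<and> 0 \<le> g x" for x
    using k_monotone_density_imp_decreasing_density[OF k f]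
      k_monotone_density_imp_decreasing_density[OF k g] by (auto simp: decreasing_density_nonneg)
  have "(\<integral>\<^sup>+x\<in>{0<..}. ennreal ((1 - e) * f x + e * g x) \<partial>lborel)
      = (\<integral>\<^sup>+x. ennreal (1 - e) * (ennreal (f x) * indicator {0<..} x)
              + ennreal e * (ennreal (g x) * indicator {0<..} x) \<partial>lborel)"
    using nn e by (intro nn_integral_cong) (auto simp: indicator_def ennreal_plus ennreal_mult)
  also have "\<dots> = ennreal (1 - e) * (\<integral>\<^sup>+x\<in>{0<..}. ennreal (f x) \<partial>lborel)
      + ennreal e * (\<integral>\<^sup>+x\<in>{0<..}. ennreal (g x) \<partial>lborel)"
    using meas[OF f] meas[OF g] by (subst nn_integral_add) (auto simp: nn_integral_cmult)
  also have "\<dots> = 1"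
    using f g e by (simp add: k_monotone_densities_def flip: ennreal_plus)
  finally show ?thesis
    using k_monotone_convex_combination[OF _ _ e, of k f g] f g by (auto simp: k_monotone_densities_def)
qed

text \<open>
  The sum is the integral of the step function that takes on each cell the value of \<open>v\<close> at the right
  endpoint, which lies below \<open>v\<close>.
\<close>

lemma decreasing_density_riemann_sum_le:
  assumes v: "decreasing_density v" and h: "0 < h"
  shows "(\<Sum>j=1..m. h * v (h * real j)) \<le> 1"
proof -
  let ?I = "\<lambda>j. {h * (real j - 1)<..h * real j}"
  have nn: "0 \<le> v (h * real j)" if "j \<in> {1..m}" for j
    using that h by (intro decreasing_density_nonneg[OF v]) auto
  have "ennreal (\<Sum>j=1..m. h * v (h * real j)) = (\<Sum>j=1..m. ennreal (v (h * real j)) * emeasure lborel (?I j))"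
    using nn h by (subst sum_ennreal[symmetric]) (auto simp: algebra_simps ennreal_mult'' intro!: sum.cong)
  also have "\<dots> = (\<integral>\<^sup>+x. (\<Sum>j=1..m. ennreal (v (h * real j)) * indicator (?I j) x) \<partial>lborel)"
    by (subst nn_integral_sum) (auto simp: nn_integral_cmult)
  also have "\<dots> \<le> (\<integral>\<^sup>+x\<in>{0<..}. ennreal (v x) \<partial>lborel)"
  proof (intro nn_integral_mono)
    fix x
    show "(\<Sum>j=1..m. ennreal (v (h * real j)) * indicator (?I j) x) \<le> ennreal (v x) * indicator {0<..} x"
    proof (cases "\<exists>j\<in>{1..m}. x \<in> ?I j")
      case False
      then have "(\<Sum>j=1..m. ennreal (v (h * real j)) * indicator (?I j) x) = 0"
        by (intro sum.neutral) auto
      then show ?thesis by simp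
    next
      case True
      then obtain j where j: "j \<in> {1..m}" "x \<in> ?I j" by blast
      have "x \<notin> ?I i" if "i \<noteq> j" for i
      proof
        assume i: "x \<in> ?I i"
        with j have "h * (real j - 1) < h * real i" "h * (real i - 1) < h * real j" by auto
        then have "real j - 1 < real i" "real i - 1 < real j" using h by auto
        then show False using that by linarith
      qed
      then have "(\<Sum>i=1..m. ennreal (v (h * real i)) * indicator (?I i) x)
          = (\<Sum>i\<in>{j}. ennreal (v (h * real i)) * indicator (?I i) x)"
        using j(1) by (intro sum.mono_neutral_right) auto
      also have "\<dots> = ennreal (v (h * real j))" using j by simp
      also have "\<dots> \<le> ennreal (v x) * indicator {0<..} x"
      proof -
        have "0 \<le> h * (real j - 1)" using j h by auto
        then have "0 < x" using j(2) by auto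
        then show ?thesis using decreasing_density_antimono[OF v, of x "h * real j"] j
          by (auto intro!: ennreal_leI)
      qed
      finally show ?thesis .
    qed
  qed
  also have "\<dots> = 1" using v by (simp add: decreasing_density_def)
  finally show ?thesis by simp
qed

text \<open>
  The case of a single cell from \<open>0\<close> to \<open>x\<close>. The bound serves both as a lower bound on the weights
  \<open>1 / v\<close> in the chi-square distance and as uniform control of the tails.
\<close>

lemma decreasing_density_le_inverse:
  assumes "decreasing_density v" "0 < x"
  shows "v x \<le> 1 / x"
  using decreasing_density_riemann_sum_le[OF assms, of 1] assms(2) by (simp add: field_simps)

section \<open>The score inequality\<close>

lemma log_likelihood_eq:
  assumes "\<And>i. i < n \<Longrightarrow> 0 < g (x i)"
  shows "log_likelihood n x g = ereal ((\<Sum>i<n. ln (g (x i))) / real n)"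
proof -
  have "(\<Sum>i<n. log_ext (g (x i))) = (\<Sum>i<n. ereal (ln (g (x i))))"
    using assms by (intro sum.cong) (auto simp: log_ext_def)
  then show ?thesis by (simp add: log_likelihood_def)
qed

text \<open>
  The true density has a finite log-likelihood, so the maximum is finite too, and a zero of the
  maximizer at an observation would make it \<open>-\<infinity>\<close>.
\<close>

lemma mle_positive_at_sample:
  assumes mle: "is_k_monotone_mle k n x g" and g0: "g0 \<in> k_monotone_densities k"
    and pos: "\<And>i. i < n \<Longrightarrow> 0 < g0 (x i)" and i: "i < n"
  shows "0 < g (x i)"
proof (rule ccontr)
  assume neg: "\<not> 0 < g (x i)"
  have "(\<Sum>i<n. log_ext (g (x i))) = log_ext (g (x i)) + (\<Sum>j\<in>{..<n} - {i}. log_ext (g (x j)))"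
    using i by (intro sum.remove) auto
  also have "\<dots> = -\<infinity>"
  proof -
    have "(\<Sum>j\<in>{..<n} - {i}. log_ext (g (x j))) \<noteq> \<infinity>"
      by (auto simp: sum_Pinfty log_ext_def)
    then show ?thesis using neg by (simp add: log_ext_def)
  qed
  finally have "log_likelihood n x g = -\<infinity>"
    using i by (simp add: log_likelihood_def)
  moreover have "log_likelihood n x g0 \<le> log_likelihood n x g"
    using mle g0 by (auto simp: is_k_monotone_mle_def)
  ultimately show False by (simp add: log_likelihood_eq pos)
qed

text \<open>
  The log-likelihood of \<open>(1 - e) * g + e * g0\<close> exceeds that of \<open>g\<close> by the sum of the
  \<open>ln (1 + e * (r i - 1))\<close> with \<open>r i = g0 (x i) / g (x i)\<close>, up to the factor \<open>1 / n\<close>. Its derivative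
  at \<open>e = 0\<close> is the sum of the \<open>r i - 1\<close>; were it positive, a small mixture would beat the maximizer.
\<close>

lemma mle_score_inequality:
  assumes k: "2 \<le> k" and mle: "is_k_monotone_mle k n x g" and g0: "g0 \<in> k_monotone_densities k"
    and pos: "\<And>i. i < n \<Longrightarrow> 0 < g0 (x i)"
  shows "(\<Sum>i<n. g0 (x i) / g (x i)) \<le> real n"
proof (rule ccontr)
  assume neg: "\<not> ?thesis"
  define r where "r = (\<lambda>i. g0 (x i) / g (x i))"
  have gpos: "0 < g (x i)" if "i < n" for i
    using mle_positive_at_sample[OF mle g0 pos that] by blast
  have r: "0 < r i" if "i < n" for i using pos gpos that by (simp add: r_def)
  have n: "n > 0" using neg by (cases n) auto
  have "((\<lambda>e. \<Sum>i<n. ln (1 + e * (r i - 1))) has_real_derivative (\<Sum>i<n. r i - 1)) (at 0)"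
    by (auto intro!: derivative_eq_intros sum.cong)
  moreover have "0 < (\<Sum>i<n. r i - 1)"
    using neg by (simp add: r_def sum_subtractf)
  ultimately obtain d where d: "0 < d"
      "\<And>e. 0 < e \<Longrightarrow> e < d \<Longrightarrow> (\<Sum>i<n. ln (1 + 0 * (r i - 1))) < (\<Sum>i<n. ln (1 + e * (r i - 1)))"
    using DERIV_pos_inc_right[of "\<lambda>e. \<Sum>i<n. ln (1 + e * (r i - 1))" "\<Sum>i<n. r i - 1" 0] by auto
  (* e < d makes the increment positive; e < 1 keeps the mixture convex and its logarithm defined. *)
  define e where "e = min (d / 2) (1 / 2)"
  have e: "0 < e" "e < d" "e \<le> 1/2" using d(1) by (auto simp: e_def min_def)
  define f where "f = (\<lambda>y. (1 - e) * g y + e * g0 y)"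
  have "f \<in> k_monotone_densities k"
    unfolding f_def using mle e
    by (intro k_monotone_densities_convex_combination k g0) (auto simp: is_k_monotone_mle_def)
  then have "log_likelihood n x f \<le> log_likelihood n x g"
    using mle by (auto simp: is_k_monotone_mle_def)
  moreover have fg: "f (x i) = g (x i) * (1 + e * (r i - 1))" if "i < n" for i
    using gpos[OF that] by (simp add: f_def r_def field_simps)
  have pos': "0 < 1 + e * (r i - 1)" if "i < n" for i
    using mult_pos_pos[OF e(1) r[OF that]] e by (simp add: algebra_simps)
  have fpos: "0 < f (x i)" if "i < n" for i
    using fg[OF that] pos'[OF that] gpos[OF that] by simp
  ultimately have "(\<Sum>i<n. ln (f (x i))) \<le> (\<Sum>i<n. ln (g (x i)))"
    using gpos n by (simp add: log_likelihood_eq divide_le_cancel)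
  moreover have "(\<Sum>i<n. ln (f (x i))) = (\<Sum>i<n. ln (g (x i)) + ln (1 + e * (r i - 1)))"
    using fg gpos pos' by (intro sum.cong) (auto simp: ln_mult_pos)
  moreover have "0 < (\<Sum>i<n. ln (1 + e * (r i - 1)))" using d(2)[OF e(1,2)] by simp
  ultimately show False by (simp add: sum.distrib)
qed

section \<open>A chi-square bound on a grid\<close>

lemma score_empty_cell:
  assumes v: "decreasing_density v" and t: "0 < a"
    and x: "\<And>i. i < n \<Longrightarrow> 0 < v (x i)" and va: "v a = 0"
  shows "{i. i < n \<and> x i \<in> {a<..b}} = {}"
proof -
  have "v (x i) \<le> 0" if "x i \<in> {a<..b}" for i
    using decreasing_density_antimono[OF v t, of "x i"] that va by auto
  then show ?thesis using x by fastforce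
qed

text \<open>
  Keeping only the observations in the cells and bounding \<open>u / v\<close> below by its value at the corners
  turns the score inequality into \<open>(1 - eta) * (\<Sum>j. h * w\<^sub>j\<^sup>2 / s\<^sub>j) \<le> 1\<close>; the square is then
  completed with the help of the two Riemann sums. The second claim takes care of the cells on which
  the chi-square term is not meaningful: if \<open>s\<^sub>j = 0\<close>, the cell contains no observation, and then
  the lower bound on its frequency forces \<open>w\<^sub>j = 0\<close>.
\<close>

lemma score_chi_square_bound:
  fixes u v :: "real \<Rightarrow> real" and x :: "nat \<Rightarrow> real"
  assumes u: "decreasing_density u" and v: "decreasing_density v"
    and h: "0 < h" and eta: "0 \<le> eta" "eta \<le> 1/2" and n: "0 < n"
    and x: "\<And>i. i < n \<Longrightarrow> 0 < v (x i)"
    and score: "(\<Sum>i<n. u (x i) / v (x i)) \<le> real n"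
    and xpos: "\<And>i. i < n \<Longrightarrow> 0 < x i"
    and freq: "\<And>j. j \<in> {1..m} \<Longrightarrow> (1 - eta) * (h * u (h * (real j + 1)))
       \<le> real (card {i. i < n \<and> x i \<in> {h * real j<..h * (real j + 1)}}) / real n"
    and mass: "1 - eta \<le> (\<Sum>j=1..m. h * u (h * (real j + 1)))"
  shows "(\<Sum>j=1..m. h * ((u (h * (real j + 1)) - v (h * real j))\<^sup>2 / v (h * real j))) \<le> 4 * eta"
    and "\<And>j. j \<in> {1..m} \<Longrightarrow> v (h * real j) = 0 \<Longrightarrow> u (h * (real j + 1)) = 0"
proof -
  define w where "w = (\<lambda>j. u (h * (real j + 1)))"
  define s where "s = (\<lambda>j. v (h * real j))"
  define C where "C = (\<lambda>j. {i. i < n \<and> x i \<in> {h * real j<..h * (real j + 1)}})"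
  have w0: "0 \<le> w j" for j
    unfolding w_def using h by (intro decreasing_density_nonneg[OF u]) auto
  have s0: "0 \<le> s j" if "1 \<le> j" for j
    unfolding s_def using h that by (intro decreasing_density_nonneg[OF v]) auto
  show zero: "u (h * (real j + 1)) = 0" if j: "j \<in> {1..m}" and vz: "v (h * real j) = 0" for j
  proof -
    have "{i. i < n \<and> x i \<in> {h * real j<..h * (real j + 1)}} = {}"
      using j h vz by (intro score_empty_cell[OF v _ x]) auto
    with freq[OF j] have "(1 - eta) * (h * w j) \<le> 0" unfolding w_def by (metis card.empty div_0 of_nat_0)
    then have "w j \<le> 0" using eta h by (auto simp: mult_le_0_iff)
    with w0[of j] show ?thesis by (simp add: w_def)
  qed
  have fin: "finite (C j)" for j by (simp add: C_def)
  have disj: "C i \<inter> C j = {}" if "i \<noteq> j" for i j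
  proof (rule ccontr)
    assume "C i \<inter> C j \<noteq> {}"
    then obtain l where "x l \<in> {h * real j<..h * (real j + 1)}" "x l \<in> {h * real i<..h * (real i + 1)}"
      by (auto simp: C_def)
    then have "h * real j < h * (real i + 1)" "h * real i < h * (real j + 1)" by auto
    then have "real j < real i + 1" "real i < real j + 1" using h by auto
    then show False using that by linarith
  qed
  have cell: "real (card (C j)) * (w j / s j) \<le> (\<Sum>i\<in>C j. u (x i) / v (x i))" if j: "j \<in> {1..m}" for j
  proof -
    have "w j / s j \<le> u (x i) / v (x i)" if i: "i \<in> C j" for i
    proof (rule frac_le)
      have *: "i < n" "h * real j < x i" "x i \<le> h * (real j + 1)" using i by (auto simp: C_def)
      have hj: "0 < h * real j" using h j by auto
      show "0 \<le> u (x i)" using * hj by (intro decreasing_density_nonneg[OF u]) auto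
      show "w j \<le> u (x i)" unfolding w_def using * hj by (intro decreasing_density_antimono[OF u]) auto
      show "0 < v (x i)" using x * by auto
      show "v (x i) \<le> s j" unfolding s_def using * hj by (intro decreasing_density_antimono[OF v]) auto
    qed
    then have "(\<Sum>i\<in>C j. w j / s j) \<le> (\<Sum>i\<in>C j. u (x i) / v (x i))" by (intro sum_mono) auto
    then show ?thesis by simp
  qed
  have "(1 - eta) * (\<Sum>j=1..m. h * ((w j)\<^sup>2 / s j)) = (\<Sum>j=1..m. ((1 - eta) * (h * w j)) * (w j / s j))"
    by (simp add: sum_distrib_left power2_eq_square mult_ac)
  also have "\<dots> \<le> (\<Sum>j=1..m. real (card (C j)) / real n * (w j / s j))"
    using freq w0 s0 by (intro sum_mono mult_right_mono) (auto simp: w_def C_def)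
  also have "\<dots> = (\<Sum>j=1..m. real (card (C j)) * (w j / s j)) / real n"
    by (simp add: sum_divide_distrib mult_ac)
  also have "\<dots> \<le> (\<Sum>j=1..m. \<Sum>i\<in>C j. u (x i) / v (x i)) / real n"
    by (intro divide_right_mono sum_mono cell) auto
  also have "(\<Sum>j=1..m. \<Sum>i\<in>C j. u (x i) / v (x i)) = (\<Sum>i\<in>(\<Union>j\<in>{1..m}. C j). u (x i) / v (x i))"
    using fin disj by (intro sum.UNION_disjoint[symmetric]) auto
  also have "\<dots> \<le> (\<Sum>i<n. u (x i) / v (x i))"
  proof (rule sum_mono2)
    show "0 \<le> u (x i) / v (x i)" if "i \<in> {..<n} - (\<Union>j\<in>{1..m}. C j)" for i
      using that x[of i] decreasing_density_nonneg[OF u xpos[of i]] by auto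
  qed (auto simp: C_def)
  also have "\<dots> \<le> real n" by (rule score)
  finally have A: "(1 - eta) * (\<Sum>j=1..m. h * ((w j)\<^sup>2 / s j)) \<le> 1"
    using n by (simp add: divide_right_mono)
  let ?A = "\<Sum>j=1..m. h * ((w j)\<^sup>2 / s j)"
  have "?A \<le> 1 / (1 - eta)" using A eta by (simp add: field_simps)
  also have "\<dots> \<le> 1 + 2 * eta"
  proof -
    have "eta * eta \<le> eta * (1/2)" using eta by (intro mult_left_mono) auto
    then show ?thesis using eta by (simp add: field_simps)
  qed
  finally have A': "?A \<le> 1 + 2 * eta" .
  have "(\<Sum>j=1..m. h * ((w j - s j)\<^sup>2 / s j)) = (\<Sum>j=1..m. h * ((w j)\<^sup>2 / s j) - 2 * (h * w j) + h * s j)"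
  proof (intro sum.cong refl)
    fix j assume j: "j \<in> {1..m}"
    show "h * ((w j - s j)\<^sup>2 / s j) = h * ((w j)\<^sup>2 / s j) - 2 * (h * w j) + h * s j"
    proof (cases "s j = 0")
      case True
      then have "w j = 0" using zero[OF j] by (simp add: w_def s_def)
      with True show ?thesis by simp
    next
      case False
      then show ?thesis by (simp add: field_simps power2_eq_square)
    qed
  qed
  also have "\<dots> = ?A - 2 * (\<Sum>j=1..m. h * w j) + (\<Sum>j=1..m. h * s j)"
    by (simp add: sum.distrib sum_subtractf sum_distrib_left)
  also have "\<dots> \<le> 4 * eta"
    using A' mass decreasing_density_riemann_sum_le[OF v h, of m]
    unfolding w_def s_def by argo
  finally show "(\<Sum>j=1..m. h * ((u (h * (real j + 1)) - v (h * real j))\<^sup>2 / v (h * real j))) \<le> 4 * eta"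
    by (simp add: w_def s_def)
qed

section \<open>Empirical frequencies\<close>

text \<open>
  The strong law of large numbers for indicators: Hoeffding's inequality bounds the probability of a
  deviation by a geometric sequence in \<open>n\<close>, so by Borel-Cantelli almost surely only finitely many
  deviations of a given size occur.
\<close>

lemma (in prob_space) empirical_frequency_tendsto:
  fixes X :: "nat \<Rightarrow> 'a \<Rightarrow> real"
  assumes indep: "indep_vars (\<lambda>_. borel) X UNIV"
    and distr: "\<And>i. distr M borel (X i) = Q" and A[measurable]: "A \<in> sets borel"
  shows "AE \<omega> in M. (\<lambda>n. real (card {i. i < n \<and> X i \<omega> \<in> A}) / real n) \<longlonglongrightarrow> measure Q A"
proof -
  have X[measurable]: "X i \<in> borel_measurable M" for i
    using indep by (auto simp: indep_vars_def)
  define Y :: "nat \<Rightarrow> 'a \<Rightarrow> real" where "Y = (\<lambda>i \<omega>. indicator A (X i \<omega>))"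
  have Y[measurable]: "Y i \<in> borel_measurable M" for i unfolding Y_def by measurable
  have distrY: "distr M borel (Y i) = distr M borel (Y 0)" for i
  proof -
    have "distr M borel (Y i) = distr (distr M borel (X i)) borel (indicator A)" for i
      by (subst distr_distr) (auto simp: Y_def comp_def)
    then show ?thesis by (simp add: distr)
  qed
  have EY: "expectation (Y 0) = measure Q A"
  proof -
    have "expectation (Y 0) = (\<integral>x. indicator A x \<partial>distr M borel (X 0))"
      by (subst integral_distr) (auto simp: Y_def)
    also have "\<dots> = measure Q A" by (simp add: distr[of 0, symmetric])
    finally show ?thesis .
  qed
  have dev: "prob {\<omega>\<in>space M. \<bar>(\<Sum>i<n. Y i \<omega>) / real n - measure Q A\<bar> \<ge> \<epsilon>}
      \<le> 2 * exp (- 2 * \<epsilon>\<^sup>2) ^ n" if "0 < \<epsilon>" for \<epsilon> n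
  proof (cases "n = 0")
    case True
    have "prob {\<omega>\<in>space M. \<bar>(\<Sum>i<n. Y i \<omega>) / real n - measure Q A\<bar> \<ge> \<epsilon>} \<le> 1" by (rule prob_le_1)
    also have "\<dots> \<le> 2 * exp (- 2 * \<epsilon>\<^sup>2) ^ n" using True by simp
    finally show ?thesis .
  next
    case False
    have "indep_vars (\<lambda>_. borel) Y {..<n}"
      using indep_vars_compose2[OF indep_vars_subset[OF indep, of "{..<n}"], of "\<lambda>_. indicator A" "\<lambda>_. borel"]
      by (simp add: Y_def)
    moreover have "AE \<omega> in M. Y 0 \<omega> \<in> {0..1}" by (auto simp: Y_def indicator_def)
    ultimately interpret H: Hoeffding_ineq_iid M "{..<n}" Y "Y 0" 0 1 "expectation (Y 0)"
      by unfold_locales (use distrY in auto)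
    have "exp (- (real n * (2 * \<epsilon>\<^sup>2))) = exp (- (2 * \<epsilon>\<^sup>2)) ^ n"
      using exp_of_nat_mult[of n "- (2 * \<epsilon>\<^sup>2)"] by simp
    then show ?thesis
      using H.Hoeffding_ineq_abs_ge'[of \<epsilon>] that False by (simp add: EY mult_ac lessThan_empty_iff)
  qed
  have conv: "AE \<omega> in M. eventually (\<lambda>n. \<bar>(\<Sum>i<n. Y i \<omega>) / real n - measure Q A\<bar> < \<epsilon>) sequentially"
    if "0 < \<epsilon>" for \<epsilon>
  proof -
    let ?B = "\<lambda>n. {\<omega>\<in>space M. \<bar>(\<Sum>i<n. Y i \<omega>) / real n - measure Q A\<bar> \<ge> \<epsilon>}"
    have "AE \<omega> in M. eventually (\<lambda>n. \<omega> \<in> space M - ?B n) sequentially"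
    proof (rule borel_cantelli_AE1)
      show "?B n \<in> sets M" for n by measurable
      show "emeasure M (?B n) < \<infinity>" for n by (simp add: emeasure_eq_measure)
      show "summable (\<lambda>n. prob (?B n))"
        using dev[OF that] that
        by (intro summable_comparison_test'[OF summable_mult[OF summable_geometric[of "exp (- 2 * \<epsilon>\<^sup>2)"]], where N=0])
           auto
    qed
    then show ?thesis by (auto elim!: eventually_mono AE_mp simp: not_le)
  qed
  have "AE \<omega> in M. \<forall>m. eventually (\<lambda>n. \<bar>(\<Sum>i<n. Y i \<omega>) / real n - measure Q A\<bar> < inverse (real (Suc m))) sequentially"
    by (subst AE_all_countable) (auto intro!: conv)
  then show ?thesis
  proof (rule AE_mp, intro AE_I2 impI)
    fix \<omega> assume *: "\<forall>m. eventually (\<lambda>n. \<bar>(\<Sum>i<n. Y i \<omega>) / real n - measure Q A\<bar> < inverse (real (Suc m))) sequentially"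
    have card: "(\<Sum>i<n. Y i \<omega>) = real (card {i. i < n \<and> X i \<omega> \<in> A})" for n
    proof -
      have "(\<Sum>i<n. Y i \<omega>) = (\<Sum>i\<in>{i. i < n \<and> X i \<omega> \<in> A}. 1)"
        by (intro sum.mono_neutral_cong_right) (auto simp: Y_def indicator_def)
      then show ?thesis by simp
    qed
    show "(\<lambda>n. real (card {i. i < n \<and> X i \<omega> \<in> A}) / real n) \<longlonglongrightarrow> measure Q A"
    proof (rule tendstoI)
      fix e :: real assume "0 < e"
      then obtain m where "inverse (real (Suc m)) < e" using reals_Archimedean by blast
      with *[rule_format, of m]
      show "eventually (\<lambda>n. dist (real (card {i. i < n \<and> X i \<omega> \<in> A}) / real n) (measure Q A) < e) sequentially"
        by (auto simp: card dist_real_def elim: eventually_mono)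
    qed
  qed
qed

section \<open>Convergence at a rational point\<close>

definition law :: "(real \<Rightarrow> real) \<Rightarrow> real measure" where
  "law u = density lborel (\<lambda>x. ennreal (u x) * indicator {0<..} x)"

lemma emeasure_law:
  assumes [measurable]: "(\<lambda>x. ennreal (u x) * indicator {0<..} x) \<in> borel_measurable lborel"
    and "A \<in> sets borel"
  shows "emeasure (law u) A = (\<integral>\<^sup>+x. ennreal (u x) * indicator {0<..} x * indicator A x \<partial>lborel)"
  using assms unfolding law_def by (subst emeasure_density) auto

lemma emeasure_law_Ioi:
  assumes u: "decreasing_density u" and m: "(\<lambda>x. ennreal (u x) * indicator {0<..} x) \<in> borel_measurable lborel"
  shows "emeasure (law u) {0<..} = 1"
proof -
  have "emeasure (law u) {0<..} = (\<integral>\<^sup>+x. ennreal (u x) * indicator {0<..} x \<partial>lborel)"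
    by (subst emeasure_law[OF m]) (auto intro!: nn_integral_cong simp: indicator_def)
  then show ?thesis using u by (simp add: decreasing_density_def)
qed

lemma prob_space_law:
  assumes u: "decreasing_density u" and m: "(\<lambda>x. ennreal (u x) * indicator {0<..} x) \<in> borel_measurable lborel"
  shows "prob_space (law u)"
proof
  have "emeasure (law u) UNIV = (\<integral>\<^sup>+x. ennreal (u x) * indicator {0<..} x \<partial>lborel)"
    by (subst emeasure_law[OF m]) auto
  then show "emeasure (law u) (space (law u)) = 1"
    using u by (simp add: decreasing_density_def law_def)
qed

lemma law_Ioc_ge:
  assumes u: "decreasing_density u" and m[measurable]: "(\<lambda>x. ennreal (u x) * indicator {0<..} x) \<in> borel_measurable lborel"
    and ab: "0 \<le> a" "a < b"
  shows "(b - a) * u b \<le> measure (law u) {a<..b}"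
proof -
  interpret prob_space "law u" by (rule prob_space_law[OF u m])
  have "ennreal ((b - a) * u b) = (\<integral>\<^sup>+x. ennreal (u b) * indicator {a<..b} x \<partial>lborel)"
    using ab decreasing_density_nonneg[OF u, of b]
    by (simp add: nn_integral_cmult ennreal_mult mult.commute)
  also have "\<dots> \<le> (\<integral>\<^sup>+x. ennreal (u x) * indicator {0<..} x * indicator {a<..b} x \<partial>lborel)"
    using ab decreasing_density_antimono[OF u]
    by (intro nn_integral_mono) (auto simp: indicator_def intro!: ennreal_leI)
  also have "\<dots> = emeasure (law u) {a<..b}" by (simp add: emeasure_law[OF m])
  finally show ?thesis by (simp add: emeasure_eq_measure)
qed

lemma law_Ioc_le:
  assumes u: "decreasing_density u" and m[measurable]: "(\<lambda>x. ennreal (u x) * indicator {0<..} x) \<in> borel_measurable lborel"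
    and ab: "0 < a" "a < b"
  shows "measure (law u) {a<..b} \<le> (b - a) * u a"
proof -
  interpret prob_space "law u" by (rule prob_space_law[OF u m])
  have "emeasure (law u) {a<..b} = (\<integral>\<^sup>+x. ennreal (u x) * indicator {0<..} x * indicator {a<..b} x \<partial>lborel)"
    by (simp add: emeasure_law[OF m])
  also have "\<dots> \<le> (\<integral>\<^sup>+x. ennreal (u a) * indicator {a<..b} x \<partial>lborel)"
    using ab decreasing_density_antimono[OF u]
    by (intro nn_integral_mono) (auto simp: indicator_def intro!: ennreal_leI)
  also have "\<dots> = ennreal ((b - a) * u a)"
    using ab decreasing_density_nonneg[OF u, of a]
    by (simp add: nn_integral_cmult ennreal_mult mult.commute)
  finally show ?thesis using ab decreasing_density_nonneg[OF u, of a] by (simp add: emeasure_eq_measure)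
qed

text \<open>
  Each summand with index \<open>j\<close> dominates the mass of the next cell, from \<open>h * (j + 1)\<close> to
  \<open>h * (j + 2)\<close>, since \<open>u\<close> is largest at the left endpoint. This shift by one cell is why the interval
  starts at \<open>2 * h\<close>.
\<close>

lemma law_grid_mass:
  assumes u: "decreasing_density u" and m: "(\<lambda>x. ennreal (u x) * indicator {0<..} x) \<in> borel_measurable lborel"
    and h: "0 < h"
  shows "measure (law u) {2 * h<..real m * h} \<le> (\<Sum>j=1..m. h * u (h * (real j + 1)))"
proof -
  interpret prob_space "law u" by (rule prob_space_law[OF u m])
  have sets[simp]: "sets (law u) = sets borel" by (simp add: law_def)
  have cell: "measure (law u) {h * (real j + 1)<..h * (real j + 2)} \<le> h * u (h * (real j + 1))" for j
    using law_Ioc_le[OF u m, of "h * (real j + 1)" "h * (real j + 2)"] h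
    by (simp add: algebra_simps add_pos_nonneg)
  have "measure (law u) {2 * h<..(real m + 2) * h} \<le> (\<Sum>j=1..m. h * u (h * (real j + 1)))"
  proof (induction m)
    case 0 show ?case by simp
  next
    case (Suc m)
    have "{2 * h<..(real (Suc m) + 2) * h} \<subseteq> {2 * h<..(real m + 2) * h}
        \<union> {h * (real (Suc m) + 1)<..h * (real (Suc m) + 2)}"
      by (auto simp: algebra_simps)
    then have "measure (law u) {2 * h<..(real (Suc m) + 2) * h} \<le> measure (law u) ({2 * h<..(real m + 2) * h}
        \<union> {h * (real (Suc m) + 1)<..h * (real (Suc m) + 2)})"
      by (intro finite_measure_mono) auto
    also have "\<dots> \<le> measure (law u) {2 * h<..(real m + 2) * h}
        + measure (law u) {h * (real (Suc m) + 1)<..h * (real (Suc m) + 2)}"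
      by (intro measure_Un_le) auto
    also have "\<dots> \<le> (\<Sum>j=1..Suc m. h * u (h * (real j + 1)))"
      using Suc cell[of "Suc m"] by simp
    finally show ?case .
  qed
  moreover have "measure (law u) {2 * h<..real m * h} \<le> measure (law u) {2 * h<..(real m + 2) * h}"
    using h by (intro finite_measure_mono) (auto simp: algebra_simps intro: order_trans)
  ultimately show ?thesis by linarith
qed

text \<open>
  The grid with mesh \<open>x / (p * r)\<close> and \<open>p * r * r\<close> cells becomes at the same time fine and long as
  \<open>r\<close> grows: it reaches up to \<open>x * r\<close>. It also passes through \<open>x\<close>, and the neighbourhood of radius
  \<open>x / p\<close> around \<open>x\<close> consists of exactly \<open>r\<close> cells on each side.
\<close>

lemma law_grid_tendsto:
  assumes u: "decreasing_density u" and m[measurable]: "(\<lambda>x. ennreal (u x) * indicator {0<..} x) \<in> borel_measurable lborel"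
    and x: "0 < x" and p: "0 < p"
  shows "(\<lambda>r. measure (law u) {2 * (x / (real p * real r))<..real (p * r * r) * (x / (real p * real r))}) \<longlonglongrightarrow> 1"
proof -
  interpret prob_space "law u" by (rule prob_space_law[OF u m])
  have sets[simp]: "sets (law u) = sets borel" by (simp add: law_def)
  let ?A = "\<lambda>r. {2 * (x / (real p * real (Suc r)))<..real (p * Suc r * Suc r) * (x / (real p * real (Suc r)))}"
  have A: "?A r = {2 * x / (real p * real (Suc r))<..real (Suc r) * x}" for r
  proof -
    have "real (Suc r) \<noteq> 0" by simp
    then show ?thesis using p by (simp only: of_nat_mult) (simp del: of_nat_Suc)
  qed
  have inc: "incseq ?A"
  proof (rule incseq_SucI)
    fix r
    have "2 * x / (real p * real (Suc (Suc r))) \<le> 2 * x / (real p * real (Suc r))"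
      using x p by (intro divide_left_mono) auto
    moreover have "real (Suc r) * x \<le> real (Suc (Suc r)) * x" using x by (intro mult_right_mono) auto
    ultimately show "?A r \<subseteq> ?A (Suc r)" unfolding A by auto
  qed
  have un: "(\<Union>r. ?A r) = {0<..}"
  proof (intro equalityI subsetI)
    fix y assume "y \<in> (\<Union>r. ?A r)"
    then obtain r where "2 * x / (real p * real (Suc r)) < y" unfolding A by auto
    moreover have "0 < 2 * x / (real p * real (Suc r))" using x p by simp
    ultimately have "0 < y" by linarith
    then show "y \<in> {0<..}" by simp
  next
    fix y :: real assume "y \<in> {0<..}"
    then have y: "0 < y" by simp
    obtain r where r: "max (2 * x / (real p * y)) (y / x) < real r" using reals_Archimedean2 by blast
    then have "2 * x / (real p * y) < real (Suc r)" "y / x < real (Suc r)" by auto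
    then have "y \<in> ?A r" unfolding A using x y p by (simp add: field_simps del: of_nat_Suc)
    then show "y \<in> (\<Union>r. ?A r)" by blast
  qed
  have "range ?A \<subseteq> sets (law u)" by (simp only: sets image_subset_iff) auto
  from finite_Lim_measure_incseq[OF this inc]
  have "(\<lambda>r. measure (law u) (?A r)) \<longlonglongrightarrow> measure (law u) {0<..}" unfolding un .
  moreover have "measure (law u) {0<..} = 1"
    using emeasure_law_Ioi[OF u m] by (simp add: emeasure_eq_measure)
  ultimately show ?thesis by (subst filterlim_sequentially_Suc[symmetric]) simp
qed

text \<open>
  Suppose that \<open>v\<close> and \<open>u\<close> differ by more than \<open>e\<close> at \<open>y\<close>. If \<open>v\<close> is too large at \<open>y\<close>, it is too large
  on the \<open>r\<close> cells to the left of \<open>y\<close>; if it is too small, it is too small on the \<open>r\<close> cells to the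
  right. On these cells \<open>u\<close> stays within \<open>e / 2\<close> of \<open>u y\<close>, so the gap is at least \<open>e / 2\<close>, and
  \<open>v \<le> 2 / y\<close> there. The cells have total length \<open>y / p\<close>, which gives a contribution of at least
  \<open>(y / p) * (e / 2)\<^sup>2 * (y / 2) = y\<^sup>2 * e\<^sup>2 / (8 * p)\<close>.
\<close>

lemma score_close_at_point:
  fixes u v :: "real \<Rightarrow> real" and x :: "nat \<Rightarrow> real"
  assumes u: "decreasing_density u" and v: "decreasing_density v"
    and y: "0 < y" and p: "2 \<le> p" and r: "2 \<le> r" and h: "h = y / (real p * real r)" and m: "m = p * r * r"
    and modulus: "\<And>z. \<bar>z - y\<bar> \<le> y / real p \<Longrightarrow> \<bar>u z - u y\<bar> \<le> e / 2"
    and chi: "(\<Sum>j=1..m. h * ((u (h * (real j + 1)) - v (h * real j))\<^sup>2 / v (h * real j))) \<le> K"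
    and zero: "\<And>j. j \<in> {1..m} \<Longrightarrow> v (h * real j) = 0 \<Longrightarrow> u (h * (real j + 1)) = 0"
    and e: "0 < e" and K: "K < y\<^sup>2 * e\<^sup>2 / (8 * real p)"
  shows "\<bar>v y - u y\<bar> \<le> e"
proof (rule ccontr)
  assume far: "\<not> ?thesis"
  define w where "w = (\<lambda>j. u (h * (real j + 1)))"
  define s where "s = (\<lambda>j. v (h * real j))"
  have hpos: "0 < h" using h y p r by simp
  have hr: "h * real r = y / real p" using h r by simp
  have hpr: "h * (real p * real r) = y" using h r p by simp
  have yp: "y / real p \<le> y / 2" using y p by (intro divide_left_mono) auto
  obtain J where J: "J \<subseteq> {1..m}" "card J = r" and half: "\<And>j. j \<in> J \<Longrightarrow> y / 2 \<le> h * real j"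
    and gap: "\<And>j. j \<in> J \<Longrightarrow> e / 2 \<le> \<bar>w j - s j\<bar>"
  proof (cases "v y > u y")
    case True
    let ?J = "{p * r - r..<p * r}"
    have rpr: "r \<le> p * r" "1 \<le> p * r - r" "p * r \<le> m"
    proof -
      have "2 * r \<le> p * r" using p by (intro mult_right_mono) auto
      then show "r \<le> p * r" "1 \<le> p * r - r" using r by linarith+
      show "p * r \<le> m" using r by (simp add: m)
    qed
    have lo: "y - y / real p \<le> h * real j" and hi: "h * (real j + 1) \<le> y" if "j \<in> ?J" for j
    proof -
      have "real (p * r) - real r \<le> real j" "real j + 1 \<le> real p * real r"
        using that rpr by (auto simp: of_nat_diff simp flip: of_nat_mult)
      then have "h * (real p * real r - real r) \<le> h * real j" "h * (real j + 1) \<le> h * (real p * real r)"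
        using hpos by (auto intro!: mult_left_mono)
      then show "y - y / real p \<le> h * real j" "h * (real j + 1) \<le> y"
        using hr hpr by (auto simp: right_diff_distrib)
    qed
    show ?thesis
    proof (rule that[of ?J])
      show "?J \<subseteq> {1..m}" using rpr by auto
      show "card ?J = r" using rpr by simp
      fix j assume j: "j \<in> ?J"
      show "y / 2 \<le> h * real j" using lo[OF j] yp by linarith
      then have hj: "0 < h * real j" using y by linarith
      have "v y \<le> s j" unfolding s_def using hi[OF j] hpos
        by (intro decreasing_density_antimono[OF v hj]) (auto simp: algebra_simps)
      moreover have "\<bar>w j - u y\<bar> \<le> e / 2"
        unfolding w_def using lo[OF j] hi[OF j] hpos by (intro modulus) (auto simp: algebra_simps abs_le_iff)
      ultimately show "e / 2 \<le> \<bar>w j - s j\<bar>" using True far by linarith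
    qed
  next
    case False
    let ?J = "{p * r..<p * r + r}"
    have rpr: "1 \<le> p * r" "p * r + r \<le> m"
    proof -
      show "1 \<le> p * r" using p r by simp
      have "p * r + r \<le> p * r + p * r" using p by simp
      also have "\<dots> = (p * r) * 2" by simp
      also have "\<dots> \<le> m" unfolding m using r by (intro mult_left_mono) auto
      finally show "p * r + r \<le> m" .
    qed
    have lo: "y \<le> h * real j" and hi: "h * (real j + 1) \<le> y + y / real p" if "j \<in> ?J" for j
    proof -
      have "real p * real r \<le> real j" "real j + 1 \<le> real p * real r + real r"
        using that by (auto simp flip: of_nat_mult of_nat_add)
      then have "h * (real p * real r) \<le> h * real j" "h * (real j + 1) \<le> h * (real p * real r + real r)"
        using hpos by (auto intro!: mult_left_mono)
      then show "y \<le> h * real j" "h * (real j + 1) \<le> y + y / real p"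
        using hr hpr by (auto simp: distrib_left)
    qed
    show ?thesis
    proof (rule that[of ?J])
      show "?J \<subseteq> {1..m}" using rpr by (intro subsetI) (simp only: atLeastLessThan_iff atLeastAtMost_iff, linarith)
      show "card ?J = r" by simp
      fix j assume j: "j \<in> ?J"
      show "y / 2 \<le> h * real j" using lo[OF j] y by linarith
      have "s j \<le> v y" unfolding s_def using lo[OF j] y
        by (intro decreasing_density_antimono[OF v]) auto
      moreover have "\<bar>w j - u y\<bar> \<le> e / 2"
        unfolding w_def using lo[OF j] hi[OF j] hpos by (intro modulus) (auto simp: algebra_simps abs_le_iff)
      ultimately show "e / 2 \<le> \<bar>w j - s j\<bar>" using False far by linarith
    qed
  qed
  have cell_term: "h * (e\<^sup>2 * y / 8) \<le> h * ((w j - s j)\<^sup>2 / s j)" if j: "j \<in> J" for j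
  proof -
    have hj: "0 < h * real j" using half[OF j] y by linarith
    have "0 \<le> s j" unfolding s_def by (rule decreasing_density_nonneg[OF v hj])
    moreover have "s j \<noteq> 0"
    proof
      assume "s j = 0"
      then have "w j = 0" using zero[of j] j J(1) by (auto simp: w_def s_def)
      then show False using gap[OF j] \<open>s j = 0\<close> e by simp
    qed
    ultimately have sj: "0 < s j" by simp
    have "s j \<le> 1 / (h * real j)" unfolding s_def by (rule decreasing_density_le_inverse[OF v hj])
    also have "\<dots> \<le> 1 / (y / 2)" using half[OF j] y hj by (intro divide_left_mono) auto
    finally have sj2: "s j \<le> 2 / y" by simp
    have "(e / 2)\<^sup>2 \<le> (w j - s j)\<^sup>2" using gap[OF j] e by (simp add: abs_le_square_iff[symmetric])
    then have "(e / 2)\<^sup>2 / (2 / y) \<le> (w j - s j)\<^sup>2 / s j"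
      using sj sj2 by (intro frac_le) auto
    then show ?thesis using hpos y by (intro mult_left_mono) (auto simp: power_divide)
  qed
  have "y\<^sup>2 * e\<^sup>2 / (8 * real p) = (h * real r) * (e\<^sup>2 * y / 8)"
    unfolding hr by (simp add: power2_eq_square mult_ac)
  also have "\<dots> = (\<Sum>j\<in>J. h * (e\<^sup>2 * y / 8))" using J by simp
  also have "\<dots> \<le> (\<Sum>j\<in>J. h * ((w j - s j)\<^sup>2 / s j))" by (intro sum_mono cell_term)
  also have "\<dots> \<le> (\<Sum>j=1..m. h * ((w j - s j)\<^sup>2 / s j))"
  proof (rule sum_mono2)
    fix j assume "j \<in> {1..m} - J"
    then have "0 \<le> s j" unfolding s_def using hpos by (intro decreasing_density_nonneg[OF v]) auto
    then show "0 \<le> h * ((w j - s j)\<^sup>2 / s j)" using hpos by simp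
  qed (use J in auto)
  also have "\<dots> \<le> K" using chi by (simp add: w_def s_def)
  finally show False using K by simp
qed

text \<open>
  The parameters are chosen in the order in which they depend on each other: \<open>p\<close> from the modulus of
  continuity of \<open>u\<close> at \<open>y\<close>, then the tolerance \<open>eta\<close>, then the grid through \<open>r\<close>, and at last \<open>n\<close> so
  large that the finitely many cell frequencies are accurate. The cells need accuracy in the
  multiplicative sense, as \<open>v\<close> may be arbitrarily small; a positive target \<open>h * u (h * (j + 1))\<close>
  allows this, and for the target 0 there is nothing to show.
\<close>

lemma score_consistent_at_rational:
  fixes u :: "real \<Rightarrow> real" and v :: "nat \<Rightarrow> real \<Rightarrow> real" and x :: "nat \<Rightarrow> real"
  assumes u: "decreasing_density u" and cont: "continuous_on {0<..} u"
    and m: "(\<lambda>x. ennreal (u x) * indicator {0<..} x) \<in> borel_measurable lborel"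
    and xpos: "\<And>i. 0 < x i"
    and v: "\<And>n. 1 \<le> n \<Longrightarrow> decreasing_density (v n)"
    and vpos: "\<And>n i. 1 \<le> n \<Longrightarrow> i < n \<Longrightarrow> 0 < v n (x i)"
    and score: "\<And>n. 1 \<le> n \<Longrightarrow> (\<Sum>i<n. u (x i) / v n (x i)) \<le> real n"
    and freq: "\<And>a b. a \<in> \<rat> \<Longrightarrow> b \<in> \<rat> \<Longrightarrow>
       (\<lambda>n. real (card {i. i < n \<and> x i \<in> {a<..b}}) / real n) \<longlonglongrightarrow> measure (law u) {a<..b}"
    and y: "y \<in> \<rat>" "0 < y"
  shows "(\<lambda>n. v n y) \<longlonglongrightarrow> u y"
proof (rule LIMSEQ_I)
  fix e' :: real assume "0 < e'"
  define e where "e = e' / 2"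
  have e: "0 < e" "e < e'" using \<open>0 < e'\<close> by (auto simp: e_def)
  have "isCont u y" using cont y by (simp add: continuous_on_eq_continuous_at)
  then obtain d where d: "0 < d" "\<And>z. \<bar>z - y\<bar> < d \<Longrightarrow> \<bar>u z - u y\<bar> < e / 2"
    using e unfolding continuous_at_eps_delta by (metis dist_real_def half_gt_zero)
  obtain p :: nat where p0: "max 2 (y / d) < real p" using reals_Archimedean2 by blast
  have p: "2 \<le> p" and yp: "y / real p < d" using p0 d(1) by (auto simp: field_simps)
  have modulus: "\<bar>u z - u y\<bar> \<le> e / 2" if "\<bar>z - y\<bar> \<le> y / real p" for z
    using d(2)[of z] that yp by linarith
  define eta where "eta = min (1/2) (y\<^sup>2 * e\<^sup>2 / (64 * real p))"
  have b: "0 < y\<^sup>2 * e\<^sup>2 / (64 * real p)" using e y p by simp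
  have eta: "0 < eta" "eta \<le> 1/2" "4 * eta < y\<^sup>2 * e\<^sup>2 / (8 * real p)"
  proof -
    show "0 < eta" "eta \<le> 1/2" using b by (auto simp: eta_def)
    have "eta \<le> y\<^sup>2 * e\<^sup>2 / (64 * real p)" by (simp add: eta_def)
    also have "\<dots> = y\<^sup>2 * e\<^sup>2 / (8 * real p) / 8" by simp
    finally show "4 * eta < y\<^sup>2 * e\<^sup>2 / (8 * real p)" using b by (simp add: eta_def)
  qed
  have "eventually (\<lambda>r. 1 - eta < measure (law u) {2 * (y / (real p * real r))<..real (p * r * r) * (y / (real p * real r))}) sequentially"
    using eta p by (intro order_tendstoD(1)[OF law_grid_tendsto[OF u m y(2)]]) auto
  then obtain r where r: "2 \<le> r"
      "1 - eta < measure (law u) {2 * (y / (real p * real r))<..real (p * r * r) * (y / (real p * real r))}"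
    using eventually_conj[OF eventually_ge_at_top[of 2]] by (metis (no_types, lifting) eventually_happens trivial_limit_sequentially)
  define h where "h = y / (real p * real r)"
  define N where "N = p * r * r"
  have h: "0 < h" "h \<in> \<rat>" using y p r by (auto simp: h_def)
  have mass: "1 - eta \<le> (\<Sum>j=1..N. h * u (h * (real j + 1)))"
    using r(2) law_grid_mass[OF u m h(1), of N] by (simp add: h_def N_def)
  have cell: "eventually (\<lambda>n. (1 - eta) * (h * u (h * (real j + 1)))
       \<le> real (card {i. i < n \<and> x i \<in> {h * real j<..h * (real j + 1)}}) / real n) sequentially" for j
  proof -
    have ge: "h * u (h * (real j + 1)) \<le> measure (law u) {h * real j<..h * (real j + 1)}"
      using law_Ioc_ge[OF u m, of "h * real j" "h * (real j + 1)"] h by (simp add: algebra_simps)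
    have "0 < h * (real j + 1)" using h by (intro mult_pos_pos) auto
    then have w: "0 \<le> u (h * (real j + 1))" by (rule decreasing_density_nonneg[OF u])
    show ?thesis
    proof (cases "u (h * (real j + 1)) = 0")
      case True
      then show ?thesis by simp
    next
      case False
      then have "0 < h * u (h * (real j + 1))" using w h by simp
      then have "(1 - eta) * (h * u (h * (real j + 1))) < 1 * (h * u (h * (real j + 1)))"
        using eta by (intro mult_strict_right_mono) auto
      with ge have "(1 - eta) * (h * u (h * (real j + 1))) < measure (law u) {h * real j<..h * (real j + 1)}"
        by linarith
      from order_tendstoD(1)[OF freq this] h show ?thesis
        by (auto elim!: eventually_mono)
    qed
  qed
  have "eventually (\<lambda>n. \<forall>j\<in>{1..N}. (1 - eta) * (h * u (h * (real j + 1)))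
       \<le> real (card {i. i < n \<and> x i \<in> {h * real j<..h * (real j + 1)}}) / real n) sequentially"
    by (intro eventually_ball_finite ballI cell) auto
  with eventually_ge_at_top[of 1]
  have "eventually (\<lambda>n. \<bar>v n y - u y\<bar> \<le> e) sequentially"
  proof eventually_elim
    case (elim n)
    note chi = score_chi_square_bound[OF u v[OF elim(1)] h(1) less_imp_le[OF eta(1)] eta(2) _
        vpos[OF elim(1)] score[OF elim(1)] xpos bspec[OF elim(2)] mass]
    show ?case
      using elim(1)
      by (intro score_close_at_point[OF u v[OF elim(1)] y(2) p r(1) h_def N_def modulus chi e(1) eta(3)]) auto
  qed
  then show "\<exists>no. \<forall>n\<ge>no. norm (v n y - u y) < e'"
    using e(2) by (auto simp: eventually_sequentially intro: le_less_trans)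
qed

section \<open>From rational points to uniform convergence\<close>

text \<open>
  On a rational grid \<open>q 0, \<dots>, q N\<close> on which \<open>u\<close> changes by less than \<open>e / 2\<close> from one point to the
  next, closeness at the grid points passes to the points between them by monotonicity. Beyond the grid
  both functions are at most \<open>e / 2\<close>.
\<close>

lemma decreasing_densities_uniform_limit:
  assumes u: "decreasing_density u" and cont: "continuous_on {0<..} u"
    and v: "\<And>n. 1 \<le> n \<Longrightarrow> decreasing_density (v n)"
    and lim: "\<And>q. q \<in> \<rat> \<Longrightarrow> 0 < q \<Longrightarrow> (\<lambda>n. v n q) \<longlonglongrightarrow> u q"
    and c: "0 < c" and e: "0 < (e :: real)"
  shows "eventually (\<lambda>n. \<forall>x\<ge>c. \<bar>v n x - u x\<bar> \<le> e) sequentially"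
proof -
  obtain q0 where q0: "q0 \<in> \<rat>" "c / 2 < q0" "q0 < c" using Rats_dense_in_real[of "c / 2" c] c by auto
  have q0pos: "0 < q0" using q0 c by linarith
  define B where "B = c + 2 / e + 1"
  have "compact {q0..B}" by simp
  moreover have "continuous_on {q0..B} u" using q0pos by (intro continuous_on_subset[OF cont]) auto
  ultimately have "uniformly_continuous_on {q0..B} u" by (rule compact_uniformly_continuous[rotated])
  then obtain d where d: "0 < d"
     "\<And>a b. a \<in> {q0..B} \<Longrightarrow> b \<in> {q0..B} \<Longrightarrow> dist b a < d \<Longrightarrow> dist (u b) (u a) < e / 2"
    using e unfolding uniformly_continuous_on_def by (metis half_gt_zero)
  (* A step below 1 keeps the right neighbour of any point up to c + 2 / e inside the interval. *)
  obtain s where s: "s \<in> \<rat>" "0 < s" "s < min d 1" using Rats_dense_in_real[of 0 "min d 1"] d by auto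
  define q where "q = (\<lambda>i::nat. q0 + real i * s)"
  have q: "q i \<in> \<rat>" "0 < q i" for i using q0 q0pos s by (auto simp: q_def add_pos_nonneg)
  obtain N :: nat where N: "(c + 2 / e) / s < real N" using reals_Archimedean2 by blast
  then have N': "c + 2 / e < q N" using s q0pos by (simp add: q_def field_simps)
  have "eventually (\<lambda>n. \<forall>i\<in>{..N}. \<bar>v n (q i) - u (q i)\<bar> < e / 2) sequentially"
    using tendstoD[OF lim[OF q], of "e / 2"] e
    by (intro eventually_ball_finite ballI) (simp_all add: dist_real_def)
  with eventually_ge_at_top[of 1] show ?thesis
  proof eventually_elim
    case (elim n)
    have vn: "decreasing_density (v n)" using v elim by auto
    have close: "\<bar>v n (q i) - u (q i)\<bar> < e / 2" if "i \<le> N" for i using elim that by auto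
    show ?case
    proof (intro allI impI)
      fix x assume x: "c \<le> x"
      have xpos: "0 < x" using x c by linarith
      define i where "i = nat \<lfloor>(x - q0) / s\<rfloor>"
      have "0 \<le> (x - q0) / s" using x q0 s by simp
      then have "real i \<le> (x - q0) / s" "(x - q0) / s < real i + 1" by (auto simp: i_def)
      then have xi: "q i \<le> x" "x < q (Suc i)" using s by (auto simp: q_def field_simps)
      have uq: "u x \<le> u (q i)" "u (q (Suc i)) \<le> u x" "v n x \<le> v n (q i)" "v n (q (Suc i)) \<le> v n x"
        using xi q(2) xpos decreasing_density_antimono[OF u] decreasing_density_antimono[OF vn] by auto
      show "\<bar>v n x - u x\<bar> \<le> e"
      proof (cases "x \<le> c + 2 / e")
        case True
        have "q (Suc i) = q i + s" by (simp add: q_def algebra_simps)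
        then have B: "q i \<in> {q0..B}" "q (Suc i) \<in> {q0..B}" "dist (q (Suc i)) (q i) < d"
          using xi True s by (auto simp: q_def B_def dist_real_def)
        have i: "Suc i \<le> N"
        proof (rule ccontr)
          assume "\<not> Suc i \<le> N"
          then have "real N * s \<le> real i * s" using s by (intro mult_right_mono) auto
          then have "q N \<le> q i" by (simp add: q_def)
          then show False using N' xi True by linarith
        qed
        show ?thesis
          using d(2)[OF B] close[OF i] close[of i] i uq unfolding dist_real_def by linarith
      next
        case False
        have "2 / e < x" using False c by linarith
        then have "1 / x \<le> e / 2" using e xpos by (simp add: field_simps)
        then have "u x \<le> e" "v n x \<le> e"
          using decreasing_density_le_inverse[OF u xpos] decreasing_density_le_inverse[OF vn xpos] e by linarith+
        moreover have "0 \<le> u x" "0 \<le> v n x"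
          using decreasing_density_nonneg[OF u xpos] decreasing_density_nonneg[OF vn xpos] by auto
        ultimately show ?thesis by linarith
      qed
    qed
  qed
qed

section \<open>Consistency\<close>

theorem proposition3p2:
  fixes M :: "'a measure"
    and X :: "nat \<Rightarrow> 'a \<Rightarrow> real"
    and k :: nat
    and g0 :: "real \<Rightarrow> real"
    and ghat :: "nat \<Rightarrow> 'a \<Rightarrow> real \<Rightarrow> real"
    and c :: real
  assumes "prob_space M"
    and "2 \<le> k"
    and "g0 \<in> k_monotone_densities k"
    and "prob_space.indep_vars M (\<lambda>_. borel) X UNIV"
    and "\<And>i. distributed M lborel (X i) (\<lambda>x. ennreal (g0 x) * indicator {0<..} x)"
    and "\<And>n. 1 \<le> n \<Longrightarrow> AE \<omega> in M. is_k_monotone_mle k n (\<lambda>i. X i \<omega>) (ghat n \<omega>)"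
    and "0 < c"
  shows "AE \<omega> in M. (\<lambda>n. SUP x\<in>{c..}. ereal \<bar>ghat n \<omega> x - g0 x\<bar>) \<longlonglongrightarrow> 0"
proof -
  interpret prob_space M by fact
  note k = assms(2) and g0 = assms(3)
  have u: "decreasing_density g0" using k_monotone_density_imp_decreasing_density[OF k g0] .
  have cont: "continuous_on {0<..} g0" using k_monotone_density_continuous_on[OF k g0] .
  have m[measurable]: "(\<lambda>x. ennreal (g0 x) * indicator {0<..} x) \<in> borel_measurable lborel"
    using assms(5)[of 0] by (simp add: distributed_def)
  have X[measurable]: "X i \<in> borel_measurable M" for i
    using assms(5)[of i] by (simp add: distributed_def)
  have law: "distr M borel (X i) = law g0" for i
  proof -
    have "distr M borel (X i) = distr M lborel (X i)" by (intro distr_cong) auto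
    then show ?thesis using assms(5)[of i] by (simp add: distributed_def law_def)
  qed
  have pos: "AE \<omega> in M. \<forall>i. 0 < X i \<omega> \<and> 0 < g0 (X i \<omega>)"
  proof (subst AE_all_countable, intro allI)
    fix i
    have "AE x in law g0. 0 < ennreal (g0 x) * indicator {0<..} x"
      unfolding law_def by (subst AE_density) auto
    then have "AE \<omega> in M. 0 < ennreal (g0 (X i \<omega>)) * (indicator {0<..} (X i \<omega>) :: ennreal)"
      unfolding law[of i, symmetric] by (rule AE_distrD[rotated]) auto
    then show "AE \<omega> in M. 0 < X i \<omega> \<and> 0 < g0 (X i \<omega>)"
      by eventually_elim (auto simp: indicator_def of_bool_def split: if_splits)
  qed
  have freq: "AE \<omega> in M. \<forall>z\<in>\<rat> \<times> \<rat>. (\<lambda>n. real (card {i. i < n \<and> X i \<omega> \<in> {fst z<..snd z}}) / real n)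
       \<longlonglongrightarrow> measure (law g0) {fst z<..snd z}"
    using empirical_frequency_tendsto[OF assms(4) law]
    by (subst AE_ball_countable) (auto intro!: countable_SIGMA countable_rat simp del: greaterThanAtMost_iff)
  have mle: "AE \<omega> in M. \<forall>n. 1 \<le> n \<longrightarrow> is_k_monotone_mle k n (\<lambda>i. X i \<omega>) (ghat n \<omega>)"
    by (subst AE_all_countable) (use assms(6) in \<open>auto simp: AE_conj_iff\<close>)
  from pos freq mle show ?thesis
  proof eventually_elim
    case (elim \<omega>)
    define v where "v = (\<lambda>n. ghat n \<omega>)"
    have mle: "is_k_monotone_mle k n (\<lambda>i. X i \<omega>) (v n)" if "1 \<le> n" for n
      using elim(3) that by (simp add: v_def)
    have v: "decreasing_density (v n)" if "1 \<le> n" for n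
      using mle[OF that] k_monotone_density_imp_decreasing_density[OF k] by (simp add: is_k_monotone_mle_def)
    have vpos: "0 < v n (X i \<omega>)" if "1 \<le> n" "i < n" for n i
      using mle_positive_at_sample[OF mle[OF that(1)] g0 _ that(2)] elim(1) by simp
    have score: "(\<Sum>i<n. g0 (X i \<omega>) / v n (X i \<omega>)) \<le> real n" if "1 \<le> n" for n
      using mle_score_inequality[OF k mle[OF that] g0] elim(1) by simp
    have fr: "(\<lambda>n. real (card {i. i < n \<and> X i \<omega> \<in> {a<..b}}) / real n) \<longlonglongrightarrow> measure (law g0) {a<..b}"
      if "a \<in> \<rat>" "b \<in> \<rat>" for a b
      using elim(2) that by auto
    have "(\<lambda>n. v n q) \<longlonglongrightarrow> g0 q" if "q \<in> \<rat>" "0 < q" for q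
      using elim(1) by (intro score_consistent_at_rational[OF u cont m _ v vpos score fr that]) auto
    then have unif: "eventually (\<lambda>n. \<forall>x\<ge>c. \<bar>v n x - g0 x\<bar> \<le> e) sequentially" if "0 < e" for e
      by (intro decreasing_densities_uniform_limit[OF u cont v _ assms(7) that])
    show ?case
    proof (rule order_tendstoI)
      fix a :: ereal assume "a < 0"
      have "0 \<le> (SUP x\<in>{c..}. ereal \<bar>ghat n \<omega> x - g0 x\<bar>)" for n
        by (rule SUP_upper2[of c]) auto
      with \<open>a < 0\<close> show "eventually (\<lambda>n. a < (SUP x\<in>{c..}. ereal \<bar>ghat n \<omega> x - g0 x\<bar>)) sequentially"
        by (intro always_eventually allI) (rule less_le_trans)
    next
      fix a :: ereal assume "0 < a"
      then obtain e where e: "0 < ereal e" "ereal e < a" using ereal_dense2 by blast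
      from unif[of e] e have "eventually (\<lambda>n. \<forall>x\<ge>c. \<bar>v n x - g0 x\<bar> \<le> e) sequentially" by simp
      then show "eventually (\<lambda>n. (SUP x\<in>{c..}. ereal \<bar>ghat n \<omega> x - g0 x\<bar>) < a) sequentially"
      proof eventually_elim
        case (elim n)
        then have "(SUP x\<in>{c..}. ereal \<bar>ghat n \<omega> x - g0 x\<bar>) \<le> ereal e"
          by (intro SUP_least) (auto simp: v_def)
        then show ?case using e by simp
      qed
    qed
  qed
qed

end
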